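(* Let $n\ge 3$ be an integer. Then $$Ar(P_{n,1},C_6)=\begin{cases} 7, & \text{if } n=3;\\ 9, & \text{if } n=4;\\ 14, & \text{if } n=6;\\ \lfloor \frac{5n}{2} \rfloor, & \text{if } n\ge 5,\ n\neq 6. \end{cases}$$
   Context: For integers $n\ge 3$ and $1\le k\le \lfloor \frac{n-1}{2}\rfloor$, the generalized Petersen graph $P_{n,k}$ is the simple graph with vertex set $\{u_i,v_i : 0\leq i\leq n-1\}$ ($2n$ distinct vertices) and edge set $\{u_iu_{i+1},\,u_iv_i,\,v_iv_{i+k} : 0\leq i\leq n-1\}$, subscripts taken modulo $n$; it has $3n$ edges. $C_d$ denotes the cycle on $d$ vertices. An edge-coloring of a graph $G$ is an arbitrary map from $E(G)$ to a set of colors (not necessarily proper); the number of colors of the coloring is the number of colors actually used. A copy of $H$ in $G$ is a (not necessarily induced) subgraph of $G$ isomorphic to $H$; it is rainbow if its edges receive pairwise distinct colors. The anti-Ramsey number $Ar(G,H)$ is the maximum number of colors in an edge-coloring of $G$ which has no rainbow copy of $H$; if $G$ contains no copy of $H$, then $Ar(G,H)=|E(G)|$. *)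

theory Defs
  imports Main
begin

record 'a graph =
  verts :: "'a set"
  edges :: "'a set set"

definition simple_graph :: "'a graph \<Rightarrow> bool" where
  "simple_graph G \<longleftrightarrow> (\<forall>e\<in>edges G. e \<subseteq> verts G \<and> card e = 2)"

definition subgraph :: "'a graph \<Rightarrow> 'a graph \<Rightarrow> bool" where
  "subgraph S G \<longleftrightarrow> simple_graph S \<and> verts S \<subseteq> verts G \<and> edges S \<subseteq> edges G"

definition graph_iso :: "'a graph \<Rightarrow> 'b graph \<Rightarrow> bool" where
  "graph_iso G H \<longleftrightarrow> (\<exists>f. bij_betw f (verts G) (verts H) \<and>
     (\<forall>x\<in>verts G. \<forall>y\<in>verts G. {x, y} \<in> edges G \<longleftrightarrow> {f x, f y} \<in> edges H))"

definition is_copy :: "'b graph \<Rightarrow> 'a graph \<Rightarrow> 'a graph \<Rightarrow> bool" where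
  "is_copy H G S \<longleftrightarrow> subgraph S G \<and> graph_iso H S"

definition cycle_graph :: "nat \<Rightarrow> nat graph" where
  "cycle_graph d = \<lparr>verts = {0..<d}, edges = {{i, (i + 1) mod d} | i. i < d}\<rparr>"

datatype petersen_vertex = U nat | V nat

definition gen_petersen :: "nat \<Rightarrow> nat \<Rightarrow> petersen_vertex graph" where
  "gen_petersen n k =
     \<lparr>verts = {U i | i. i < n} \<union> {V i | i. i < n},
      edges = {{U i, U ((i + 1) mod n)} | i. i < n}
            \<union> {{U i, V i} | i. i < n}
            \<union> {{V i, V ((i + k) mod n)} | i. i < n}\<rparr>"

text \<open>An edge-coloring is an arbitrary map into the natural numbers, of which only the values
  on the edges of the graph matter; a finite graph never needs any other set of colors.\<close>

type_synonym 'a edge_coloring = "'a set \<Rightarrow> nat"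

definition num_colors :: "'a graph \<Rightarrow> 'a edge_coloring \<Rightarrow> nat" where
  "num_colors G c = card (c ` edges G)"

definition rainbow :: "'a edge_coloring \<Rightarrow> 'a graph \<Rightarrow> bool" where
  "rainbow c S \<longleftrightarrow> inj_on c (edges S)"

definition has_rainbow_copy :: "'b graph \<Rightarrow> 'a graph \<Rightarrow> 'a edge_coloring \<Rightarrow> bool" where
  "has_rainbow_copy H G c \<longleftrightarrow> (\<exists>S. is_copy H G S \<and> rainbow c S)"

text \<open>Meaningful for finite \<open>G\<close>, where \<open>Max\<close> is taken over a finite set, and for \<open>H\<close> with at
  least two edges, so that a constant coloring makes that set nonempty.
  If \<open>G\<close> contains no copy of \<open>H\<close>, every coloring qualifies and the
  value is the number of edges of \<open>G\<close>, see \<open>anti_ramsey_no_copy\<close>.\<close>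

definition anti_ramsey :: "'a graph \<Rightarrow> 'b graph \<Rightarrow> nat" where
  "anti_ramsey G H = Max {num_colors G c | c. \<not> has_rainbow_copy H G c}"

lemma finite_num_colors:
  assumes "finite (edges G)"
  shows "finite {num_colors G c | c. \<not> has_rainbow_copy H G c}"
  by (rule finite_subset[of _ "{..card (edges G)}"])
     (auto simp: num_colors_def card_image_le[OF assms])

lemma anti_ramsey_no_copy:
  assumes fin: "finite (edges G)" and none: "\<nexists>S. is_copy H G S"
  shows "anti_ramsey G H = card (edges G)"
proof -
  obtain c :: "'a edge_coloring" where "inj_on c (edges G)"
    using finite_imp_inj_to_nat_seg[OF fin] by blast
  then have "num_colors G c = card (edges G)"
    by (simp add: num_colors_def card_image)
  moreover have "\<not> has_rainbow_copy H G c"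
    using none by (simp add: has_rainbow_copy_def)
  ultimately have "card (edges G) \<in> {num_colors G c | c. \<not> has_rainbow_copy H G c}"
    by force
  moreover have "m \<le> card (edges G)"
    if "m \<in> {num_colors G c | c. \<not> has_rainbow_copy H G c}" for m
    using that by (auto simp: num_colors_def card_image_le[OF fin])
  ultimately show ?thesis
    unfolding anti_ramsey_def by (intro Max_eqI finite_num_colors fin)
qed

end

theory Submission
  imports Defs
begin

text \<open>
  Call the edges of the prism outer (\<open>u\<^sub>i u\<^sub>i\<^sub>+\<^sub>1\<close>), inner (\<open>v\<^sub>i v\<^sub>i\<^sub>+\<^sub>1\<close>) and spokes (\<open>u\<^sub>i v\<^sub>i\<close>).

  Upper bound. For every \<open>i\<close> the \<open>2 \<times> 3\<close> grid on columns \<open>i, i + 1, i + 2\<close> has a 6-cycle as its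
  boundary (\<open>ladder\<close>). Every edge lies on exactly two of these \<open>n\<close> cycles. If none is rainbow, each
  repeats a color, so a color class of size \<open>s\<close> can be responsible for at most \<open>s\<close> of them, and a class
  of size 1 for none; hence for at most \<open>2 (s - 1)\<close> in any case. Summing over the classes gives
  \<open>n \<le> 2 (3 n - k)\<close> for \<open>k\<close> colors, that is \<open>k \<le> 5 n / 2\<close>. The lemma \<open>card_nonrainbow_family_le\<close>
  carries out this double counting for any family of edge sets in which single edges and pairs of
  edges are not contained too often. It also yields the smaller values for \<open>n = 6\<close>, where
  the two rims are further 6-cycles, and for \<open>n = 4\<close>, where the family of ladders is replaced by eight
  cycles that go once around the cube; for any two edges some cycle of this family contains exactly one of them,
  which makes the count more efficient.

  Lower bound. Give \<open>u\<^sub>i u\<^sub>i\<^sub>+\<^sub>1\<close> and \<open>v\<^sub>i v\<^sub>i\<^sub>+\<^sub>1\<close> a common color for every even \<open>i\<close>, and distinct colors to all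
  other edges. A 6-cycle meets the cut \<open>{u\<^sub>i u\<^sub>i\<^sub>+\<^sub>1, v\<^sub>i v\<^sub>i\<^sub>+\<^sub>1}\<close> with a parity that does not depend on \<open>i\<close>. If
  the parity is even and the cycle is rainbow, it avoids all cuts with even \<open>i\<close>, so its edges
  form disjoint 4-cycles between consecutive columns, which is absurd for a set of 6 edges. If the
  parity is odd, the cycle winds around the prism and consists of \<open>n\<close> rim edges and an even number of
  spokes, so \<open>n\<close> is 4 or 6. In these two cases identifying one more pair of colors, those of the
  cuts 0 and 2, destroys the winding cycles as well. The only properties of a
  6-cycle that enter are that it has 6 edges and that all its degrees are even
  (\<open>even_subgraph_with_6_edges_winds\<close>).
\<close>

section \<open>Colorings with no rainbow member in a family of edge sets\<close>

text \<open>
  Assign to each \<open>F i\<close> a color that it repeats. A color class of size \<open>s\<close> contains at least two edges of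
  each set assigned to it, so at most \<open>d s / 2\<close> sets are assigned to it, and at most \<open>l\<close> if \<open>s = 2\<close>.
  The condition on \<open>d\<close> and \<open>l\<close> is what makes the integer part of \<open>d s / 2\<close> at most \<open>l (s - 1)\<close>
  for all \<open>s \<ge> 3\<close>; the critical case is \<open>s = 3\<close>. The sum of \<open>s - 1\<close> over all classes is the
  number of edges minus the number of colors. The conclusion is written without subtraction.
\<close>

lemma card_nonrainbow_family_le:
  fixes E :: "'e set" and F :: "'i \<Rightarrow> 'e set" and c :: "'e \<Rightarrow> 'k"
  assumes finE: "finite E" and finI: "finite I"
    and sub: "\<And>i. i \<in> I \<Longrightarrow> F i \<subseteq> E"
    and single: "\<And>x. x \<in> E \<Longrightarrow> card {i \<in> I. x \<in> F i} \<le> d"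
    and pair: "\<And>x y. \<lbrakk>x \<in> E; y \<in> E; x \<noteq> y\<rbrakk> \<Longrightarrow> card ({i \<in> I. x \<in> F i} \<inter> {i \<in> I. y \<in> F i}) \<le> l"
    and dl: "3 * d \<le> 4 * l + 1"
    and non: "\<And>i. i \<in> I \<Longrightarrow> \<not> inj_on c (F i)"
  shows "card I + l * card (c ` E) \<le> l * card E"
proof -
  have "\<exists>k. \<exists>x\<in>F i. \<exists>y\<in>F i. x \<noteq> y \<and> c x = k \<and> c y = k" if "i \<in> I" for i
    using non[OF that] by (auto simp: inj_on_def)
  then obtain k where k: "\<And>i. i \<in> I \<Longrightarrow> \<exists>x\<in>F i. \<exists>y\<in>F i. x \<noteq> y \<and> c x = k i \<and> c y = k i"
    by metis
  define X where "X q = {x \<in> E. c x = q}" for q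
  define J where "J q = {i \<in> I. k i = q}" for q
  have finX: "finite (X q)" for q using finE by (simp add: X_def)
  have finJ: "finite (J q)" for q using finI by (simp add: J_def)
  have two: "2 \<le> card (F i \<inter> X q)" if i: "i \<in> J q" for i q
  proof -
    obtain x y where xy: "x \<in> F i" "y \<in> F i" "x \<noteq> y" "c x = q" "c y = q"
      using k[of i] i by (auto simp: J_def)
    then have "{x, y} \<subseteq> F i \<inter> X q"
      using sub[of i] i by (auto simp: J_def X_def)
    from card_mono[OF _ this] show ?thesis
      using xy finX[of q] by simp
  qed
  have class_le: "card (J q) + l \<le> l * card (X q)" if q: "q \<in> c ` E" for q
  proof -
    have "X q \<noteq> {}" using q by (auto simp: X_def)
    then have s1: "card (X q) \<ge> 1" using finX[of q] by (simp add: Suc_le_eq card_gt_0_iff)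
    have "2 * card (J q) \<le> (\<Sum>i\<in>J q. card (F i \<inter> X q))"
      using sum_mono[of "J q" "\<lambda>_. 2" "\<lambda>i. card (F i \<inter> X q)"] two by simp
    also have "\<dots> = (\<Sum>i\<in>J q. \<Sum>x\<in>X q. of_bool (x \<in> F i))"
      using finX by (intro sum.cong refl) (simp add: Int_commute)
    also have "\<dots> = (\<Sum>x\<in>X q. \<Sum>i\<in>J q. of_bool (x \<in> F i))"
      by (rule sum.swap)
    also have "\<dots> = (\<Sum>x\<in>X q. card {i \<in> J q. x \<in> F i})"
      using finJ by (intro sum.cong refl) (simp add: Int_def)
    also have "\<dots> \<le> (\<Sum>x\<in>X q. d)"
    proof (rule sum_mono)
      fix x assume "x \<in> X q"
      then have "card {i \<in> I. x \<in> F i} \<le> d" by (intro single) (simp add: X_def)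
      moreover have "card {i \<in> J q. x \<in> F i} \<le> card {i \<in> I. x \<in> F i}"
        using finI by (intro card_mono) (auto simp: J_def)
      ultimately show "card {i \<in> J q. x \<in> F i} \<le> d" by linarith
    qed
    finally have dbl: "2 * card (J q) \<le> d * card (X q)" by (simp add: mult.commute)
    consider "card (X q) = 1" | "card (X q) = 2" | "card (X q) \<ge> 3" using s1 by linarith
    then show ?thesis
    proof cases
      case 1
      have "J q = {}"
      proof (rule ccontr)
        assume "J q \<noteq> {}"
        then obtain i where "i \<in> J q" by blast
        from two[OF this] card_mono[of "X q" "F i \<inter> X q"] finX[of q] 1 show False by auto
      qed
      with 1 show ?thesis by simp
    next
      case 2
      then obtain x y where xy: "X q = {x, y}" "x \<noteq> y" by (auto simp: card_2_iff)
      have "J q \<subseteq> {i \<in> I. x \<in> F i} \<inter> {i \<in> I. y \<in> F i}"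
      proof
        fix i assume i: "i \<in> J q"
        have "F i \<inter> X q = X q"
          using two[OF i] 2 finX[of q] by (intro card_seteq) auto
        with i xy show "i \<in> {i \<in> I. x \<in> F i} \<inter> {i \<in> I. y \<in> F i}" by (auto simp: J_def)
      qed
      then have "card (J q) \<le> card ({i \<in> I. x \<in> F i} \<inter> {i \<in> I. y \<in> F i})"
        using finI by (intro card_mono) auto
      also have "\<dots> \<le> l" using xy by (intro pair) (auto simp: X_def)
      finally show ?thesis using 2 by simp
    next
      case 3
      \<comment> \<open>write \<open>s = t + 3\<close>; the claim then follows from \<open>t \<le> l t\<close> unless \<open>l = 0\<close>\<close>
      then obtain t where t: "card (X q) = t + 3" by (metis add.commute le_Suc_ex)
      have "6 * card (J q) \<le> 3 * d * (t + 3)" using dbl t by simp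
      also have "\<dots> \<le> (4 * l + 1) * (t + 3)" using dl by (intro mult_right_mono) auto
      finally have "6 * card (J q) \<le> (4 * l + 1) * (t + 3)" .
      then have le: "6 * card (J q) \<le> 4 * (l * t) + 12 * l + t + 3" by (simp add: algebra_simps)
      have "card (J q) \<le> l * t + 2 * l"
      proof (cases "l = 0")
        case True
        with dl dbl show ?thesis by (cases d) auto
      next
        case False
        then have "t \<le> l * t" by simp
        with le show ?thesis by linarith
      qed
      then show ?thesis by (simp add: t algebra_simps)
    qed
  qed
  have k_in: "k ` I \<subseteq> c ` E"
  proof
    fix q assume "q \<in> k ` I"
    then obtain i where i: "i \<in> I" "q = k i" by blast
    with k[OF i(1)] obtain x where "x \<in> F i" "c x = q" by blast
    with sub[OF i(1)] show "q \<in> c ` E" by blast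
  qed
  have "card I + l * card (c ` E) = (\<Sum>q\<in>c ` E. card (J q) + l)"
    using sum_fun_comp[OF finI _ k_in, of "\<lambda>_. 1::nat"] finE
    by (simp add: J_def sum.distrib)
  also have "\<dots> \<le> (\<Sum>q\<in>c ` E. l * card (X q))"
    by (intro sum_mono class_le)
  also have "\<dots> = l * card E"
    using sum_fun_comp[OF finE, of "c ` E" c "\<lambda>_. 1::nat"] finE
    by (simp add: X_def flip: sum_distrib_left)
  finally show ?thesis .
qed

section \<open>Rainbow copies\<close>

lemma has_rainbow_copy_iff:
  assumes H: "simple_graph H"
  shows "has_rainbow_copy H G c \<longleftrightarrow>
    (\<exists>f. inj_on f (verts H) \<and> f ` verts H \<subseteq> verts G \<and> (`) f ` edges H \<subseteq> edges G
         \<and> inj_on c ((`) f ` edges H))"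
    (is "?L \<longleftrightarrow> (\<exists>f. ?R f)")
proof
  assume ?L
  then obtain S f where S: "simple_graph S" "verts S \<subseteq> verts G" "edges S \<subseteq> edges G"
    and c: "inj_on c (edges S)" and f: "bij_betw f (verts H) (verts S)"
    and iso: "\<And>x y. x \<in> verts H \<Longrightarrow> y \<in> verts H \<Longrightarrow> {x, y} \<in> edges H \<longleftrightarrow> {f x, f y} \<in> edges S"
    by (auto simp: has_rainbow_copy_def is_copy_def subgraph_def rainbow_def graph_iso_def)
  have "(`) f ` edges H \<subseteq> edges S"
  proof
    fix e' assume "e' \<in> (`) f ` edges H"
    then obtain e where e: "e \<in> edges H" "e' = f ` e" by blast
    then obtain x y where "e = {x, y}" "x \<in> verts H" "y \<in> verts H"
      using H by (auto simp: simple_graph_def card_2_iff)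
    with e iso show "e' \<in> edges S" by auto
  qed
  then have "?R f"
    using f S c by (auto simp: bij_betw_def intro: inj_on_subset)
  then show "\<exists>f. ?R f" by blast
next
  assume "\<exists>f. ?R f"
  then obtain f where f: "inj_on f (verts H)" "f ` verts H \<subseteq> verts G"
    "(`) f ` edges H \<subseteq> edges G" "inj_on c ((`) f ` edges H)"
    by blast
  have sub: "e \<subseteq> verts H" if "e \<in> edges H" for e
    using H that by (auto simp: simple_graph_def)
  define S where "S = \<lparr>verts = f ` verts H, edges = (`) f ` edges H\<rparr>"
  have "simple_graph S"
    unfolding simple_graph_def
  proof
    fix e' assume "e' \<in> edges S"
    then obtain e where e: "e \<in> edges H" "e' = f ` e" by (auto simp: S_def)
    have "card (f ` e) = card e"
      using inj_on_subset[OF f(1) sub[OF e(1)]] by (rule card_image)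
    with e H sub[OF e(1)] show "e' \<subseteq> verts S \<and> card e' = 2"
      by (auto simp: simple_graph_def S_def)
  qed
  moreover have "{x, y} \<in> edges H \<longleftrightarrow> {f x, f y} \<in> edges S" if xy: "x \<in> verts H" "y \<in> verts H" for x y
  proof
    assume "{x, y} \<in> edges H"
    then have "f ` {x, y} \<in> (`) f ` edges H" by (rule imageI)
    then show "{f x, f y} \<in> edges S" by (simp add: S_def)
  next
    assume "{f x, f y} \<in> edges S"
    then obtain e where e: "e \<in> edges H" "f ` {x, y} = f ` e" by (auto simp: S_def)
    have "{x, y} = e"
      using inj_on_image_eq_iff[OF f(1), of "{x, y}" e] e(2) sub[OF e(1)] xy by blast
    with e show "{x, y} \<in> edges H" by simp
  qed
  ultimately have "graph_iso H S" "subgraph S G" "inj_on c (edges S)"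
    using f by (auto simp: subgraph_def graph_iso_def bij_betw_def S_def)
  then show ?L by (auto simp: has_rainbow_copy_def is_copy_def rainbow_def)
qed

text \<open>It is enough that the coloring \<open>c\<close> attains the bound from above: equality follows from the
  last assumption.\<close>

lemma anti_ramsey_eqI:
  assumes "finite (edges G)"
    and "\<not> has_rainbow_copy H G c" and "num_colors G c \<ge> m"
    and "\<And>c. \<not> has_rainbow_copy H G c \<Longrightarrow> num_colors G c \<le> m"
  shows "anti_ramsey G H = m"
proof -
  have "num_colors G c = m" using assms by (simp add: le_antisym)
  then show ?thesis
    unfolding anti_ramsey_def using assms by (intro Max_eqI finite_num_colors) auto
qed

lemma edges_cycle_graph_6:
  "edges (cycle_graph 6) = {{0, 1}, {1, 2}, {2, 3}, {3, 4}, {4, 5}, {5, 0}}"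
proof -
  have "{{i, (i + 1) mod 6} | i. i < 6} = (\<lambda>i::nat. {i, (i + 1) mod 6}) ` {..<6}" by auto
  moreover have "{..<6} = {0, 1, 2, 3, 4, 5 :: nat}" by auto
  ultimately show ?thesis by (simp add: cycle_graph_def del: One_nat_def)
qed

lemma simple_graph_cycle_6: "simple_graph (cycle_graph 6)"
  by (simp add: simple_graph_def edges_cycle_graph_6) (simp add: cycle_graph_def)

lemma even_degree_cycle_6:
  "even (card {e \<in> edges (cycle_graph 6). w \<in> e})"
proof (cases "w < 6")
  case True
  then consider "w = 0" | "w = 1" | "w = 2" | "w = 3" | "w = 4" | "w = 5" by linarith
  then have "(\<Sum>e\<in>edges (cycle_graph 6). of_bool (w \<in> e) :: nat) = 2"
    by cases (simp_all add: edges_cycle_graph_6 doubleton_eq_iff)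
  moreover have "(\<Sum>e\<in>edges (cycle_graph 6). of_bool (w \<in> e)) = card {e \<in> edges (cycle_graph 6). w \<in> e}"
    by (subst sum_of_bool_eq) (auto simp: Int_def edges_cycle_graph_6)
  ultimately show ?thesis by simp
next
  case False
  then have "{e \<in> edges (cycle_graph 6). w \<in> e} = {}" by (auto simp: edges_cycle_graph_6)
  then show ?thesis by (simp only: card.empty dvd_0_right)
qed

text \<open>This weakening of being a 6-cycle replaces a classification of the 6-cycles of the
  prism: parity at each vertex and the number of edges suffice to exclude rainbow copies.\<close>

lemma rainbow_hexagon_is_even_subgraph:
  assumes "has_rainbow_copy (cycle_graph 6) G c"
  shows "\<exists>C \<subseteq> edges G. card C = 6 \<and> inj_on c C \<and> (\<forall>w. even (card {e \<in> C. w \<in> e}))"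
proof -
  let ?H = "cycle_graph 6"
  obtain f where f: "inj_on f (verts ?H)" "(`) f ` edges ?H \<subseteq> edges G" "inj_on c ((`) f ` edges ?H)"
    using assms by (auto simp: has_rainbow_copy_iff[OF simple_graph_cycle_6])
  have sub: "e \<subseteq> verts ?H" if "e \<in> edges ?H" for e
    using simple_graph_cycle_6 that by (auto simp: simple_graph_def)
  have inj: "inj_on ((`) f) (edges ?H)"
    using sub f(1) by (auto simp: inj_on_def[of "(`) f"] inj_on_image_eq_iff)
  show ?thesis
  proof (intro exI[of _ "(`) f ` edges ?H"] conjI allI)
    show "card ((`) f ` edges ?H) = 6"
      using inj by (simp add: card_image) (simp add: edges_cycle_graph_6 doubleton_eq_iff)
    show "even (card {e \<in> (`) f ` edges ?H. w \<in> e})" for w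
    proof (cases "w \<in> f ` verts ?H")
      case True
      then obtain v where v: "v \<in> verts ?H" "w = f v" by blast
      have iff: "w \<in> f ` e \<longleftrightarrow> v \<in> e" if "e \<in> edges ?H" for e
        unfolding v(2) by (rule inj_on_image_mem_iff[OF f(1) v(1) sub[OF that]])
      have "{e \<in> (`) f ` edges ?H. w \<in> e} = (`) f ` {e \<in> edges ?H. w \<in> f ` e}"
        by (rule Compr_image_eq)
      also have "\<dots> = (`) f ` {e \<in> edges ?H. v \<in> e}"
        using iff by (intro arg_cong2[of _ _ _ _ image] Collect_cong) auto
      also have "card \<dots> = card {e \<in> edges ?H. v \<in> e}"
        using inj by (intro card_image) (auto intro: inj_on_subset)
      finally show ?thesis by (simp add: even_degree_cycle_6)
    next
      case False
      then have "{e \<in> (`) f ` edges ?H. w \<in> e} = {}" using sub by auto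
      then show ?thesis by (simp only: card.empty dvd_0_right)
    qed
  qed (use f in auto)
qed

lemma rainbow_hexagonI:
  assumes "distinct [x0, x1, x2, x3, x4, x5]"
    and "{x0, x1, x2, x3, x4, x5} \<subseteq> verts G"
    and "{{x0, x1}, {x1, x2}, {x2, x3}, {x3, x4}, {x4, x5}, {x5, x0}} \<subseteq> edges G"
    and "inj_on c {{x0, x1}, {x1, x2}, {x2, x3}, {x3, x4}, {x4, x5}, {x5, x0}}"
  shows "has_rainbow_copy (cycle_graph 6) G c"
proof -
  define xs where "xs = [x0, x1, x2, x3, x4, x5]"
  have V: "verts (cycle_graph 6) = {0, 1, 2, 3, 4, 5}"
    by (auto simp: cycle_graph_def)
  have "inj_on ((!) xs) (verts (cycle_graph 6))"
    using assms(1) by (intro inj_on_nth) (auto simp: xs_def V)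
  moreover have "(`) ((!) xs) ` edges (cycle_graph 6) =
      {{x0, x1}, {x1, x2}, {x2, x3}, {x3, x4}, {x4, x5}, {x5, x0}}"
    by (simp add: edges_cycle_graph_6 xs_def)
  moreover have "(!) xs ` verts (cycle_graph 6) = {x0, x1, x2, x3, x4, x5}"
    by (simp add: V xs_def)
  ultimately show ?thesis
    unfolding has_rainbow_copy_iff[OF simple_graph_cycle_6] using assms
    by (intro exI[of _ "(!) xs"]) simp
qed

section \<open>The prism and its edges\<close>

definition prism :: "nat \<Rightarrow> petersen_vertex graph" where
  "prism n = gen_petersen n 1"

text \<open>Indices are reduced modulo \<open>n\<close> inside the edges, so that all formulas with \<open>Suc i\<close> or \<open>i + 2\<close>
  make sense for every natural number \<open>i\<close>.\<close>

definition outer :: "nat \<Rightarrow> nat \<Rightarrow> petersen_vertex set" where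
  "outer n i = {U (i mod n), U (Suc i mod n)}"

definition inner :: "nat \<Rightarrow> nat \<Rightarrow> petersen_vertex set" where
  "inner n i = {V (i mod n), V (Suc i mod n)}"

definition spoke :: "nat \<Rightarrow> nat \<Rightarrow> petersen_vertex set" where
  "spoke n i = {U (i mod n), V (i mod n)}"

lemma edges_prism:
  "edges (prism n) = outer n ` {..<n} \<union> spoke n ` {..<n} \<union> inner n ` {..<n}"
proof -
  have eq: "{g i | i. i < n} = h ` {..<n}" if "\<And>i. i < n \<Longrightarrow> g i = h i"
    for g h :: "nat \<Rightarrow> petersen_vertex set"
    using that by (auto simp: image_iff)
  show ?thesis
    unfolding prism_def gen_petersen_def graph.select_convs
    by (intro arg_cong2[of _ _ _ _ "(\<union>)"] eq) (simp_all add: outer_def inner_def spoke_def)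
qed

lemma prism_edges_memI:
  assumes "n > 0"
  shows "outer n i \<in> edges (prism n)" "inner n i \<in> edges (prism n)"
    "spoke n i \<in> edges (prism n)"
proof -
  have "outer n i = outer n (i mod n)" "inner n i = inner n (i mod n)" "spoke n i = spoke n (i mod n)"
    by (simp_all add: outer_def inner_def spoke_def mod_Suc_eq)
  with assms show "outer n i \<in> edges (prism n)" "inner n i \<in> edges (prism n)"
    "spoke n i \<in> edges (prism n)"
    by (auto simp: edges_prism)
qed

lemma prism_edge_eq_iff:
  assumes "n \<ge> 3"
  shows "outer n i = outer n j \<longleftrightarrow> i mod n = j mod n"
    and "inner n i = inner n j \<longleftrightarrow> i mod n = j mod n"
    and "spoke n i = spoke n j \<longleftrightarrow> i mod n = j mod n"
    and "outer n i \<noteq> inner n j" and "inner n j \<noteq> outer n i"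
    and "outer n i \<noteq> spoke n j" and "spoke n j \<noteq> outer n i"
    and "inner n i \<noteq> spoke n j" and "spoke n j \<noteq> inner n i"
  using assms by (auto simp: outer_def inner_def spoke_def doubleton_eq_iff mod_Suc split: if_splits)

lemma inj_on_prism_edge:
  assumes "n \<ge> 3"
  shows "inj_on (outer n) {..<n}" "inj_on (inner n) {..<n}" "inj_on (spoke n) {..<n}"
  using assms by (auto simp: inj_on_def prism_edge_eq_iff)

lemma card_edges_prism:
  assumes "n \<ge> 3"
  shows "card (edges (prism n)) = 3 * n"
  using assms unfolding edges_prism
  by (subst card_Un_disjoint; (subst card_Un_disjoint)?)
     (auto simp: card_image inj_on_prism_edge prism_edge_eq_iff)

lemma incident_edges_prism:
  assumes "n \<ge> 3"
  shows "{e \<in> edges (prism n). U (Suc i mod n) \<in> e} = {outer n i, outer n (Suc i), spoke n (Suc i)}"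
    and "{e \<in> edges (prism n). V (Suc i mod n) \<in> e} = {inner n i, inner n (Suc i), spoke n (Suc i)}"
proof -
  have *: "U (Suc i mod n) \<in> outer n j \<longleftrightarrow> outer n j = outer n i \<or> outer n j = outer n (Suc i)"
    "V (Suc i mod n) \<in> inner n j \<longleftrightarrow> inner n j = inner n i \<or> inner n j = inner n (Suc i)"
    "U (Suc i mod n) \<in> spoke n j \<longleftrightarrow> spoke n j = spoke n (Suc i)"
    "V (Suc i mod n) \<in> spoke n j \<longleftrightarrow> spoke n j = spoke n (Suc i)"
    "U (Suc i mod n) \<notin> inner n j" "V (Suc i mod n) \<notin> outer n j" for j
    using assms unfolding prism_edge_eq_iff[OF assms]
    by (auto simp: outer_def inner_def spoke_def mod_Suc split: if_splits)
  have "e \<in> edges (prism n) \<longleftrightarrow> (\<exists>j. e = outer n j \<or> e = inner n j \<or> e = spoke n j)" for e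
  proof
    assume "e \<in> edges (prism n)"
    then show "\<exists>j. e = outer n j \<or> e = inner n j \<or> e = spoke n j"
      by (auto simp: edges_prism)
  qed (use assms prism_edges_memI[of n] in auto)
  with * show "{e \<in> edges (prism n). U (Suc i mod n) \<in> e} = {outer n i, outer n (Suc i), spoke n (Suc i)}"
    "{e \<in> edges (prism n). V (Suc i mod n) \<in> e} = {inner n i, inner n (Suc i), spoke n (Suc i)}"
    by (safe; (metis insert_iff)?)+
qed

section \<open>Even subgraphs and colorings without rainbow hexagon\<close>

text \<open>Every vertex of the prism has three edges, so by parity membership of the spoke is
  determined by membership of the two rim edges at either of its ends.\<close>

lemma spoke_in_even_subgraph_iff:
  assumes n: "n \<ge> 3" and C: "C \<subseteq> edges (prism n)"
    and ev: "\<And>w. even (card {e \<in> C. w \<in> e})"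
  shows "spoke n (Suc i) \<in> C \<longleftrightarrow> (outer n i \<in> C) \<noteq> (outer n (Suc i) \<in> C)"
    and "spoke n (Suc i) \<in> C \<longleftrightarrow> (inner n i \<in> C) \<noteq> (inner n (Suc i) \<in> C)"
proof -
  have parity: "z \<in> C \<longleftrightarrow> (x \<in> C) \<noteq> (y \<in> C)"
    if "{e \<in> edges (prism n). w \<in> e} = {x, y, z}" "distinct [x, y, z]" for w x y z
  proof -
    have "{e \<in> C. w \<in> e} = C \<inter> {x, y, z}"
      using C that(1) by blast
    then have "even (card (C \<inter> {x, y, z}))" using ev[of w] by (simp only:)
    with that(2) show ?thesis
      by (cases "x \<in> C"; cases "y \<in> C"; cases "z \<in> C") simp_all
  qed
  have "i mod n \<noteq> Suc i mod n" using n by (simp add: mod_Suc)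
  then show "spoke n (Suc i) \<in> C \<longleftrightarrow> (outer n i \<in> C) \<noteq> (outer n (Suc i) \<in> C)"
    "spoke n (Suc i) \<in> C \<longleftrightarrow> (inner n i \<in> C) \<noteq> (inner n (Suc i) \<in> C)"
    using n by (intro parity[OF incident_edges_prism(1)] parity[OF incident_edges_prism(2)];
        simp add: prism_edge_eq_iff)+
qed

lemma sum_cyclic_shift:
  fixes f :: "nat \<Rightarrow> nat"
  assumes "f n = f 0"
  shows "(\<Sum>i<n. f (Suc i)) = (\<Sum>i<n. f i)"
proof -
  have "f 0 + (\<Sum>i<n. f (Suc i)) = (\<Sum>i<n. f i) + f n"
    by (metis sum.lessThan_Suc sum.lessThan_Suc_shift)
  with assms show ?thesis by linarith
qed

text \<open>A spoke belongs to \<open>C\<close> exactly if membership of outer edges changes there. On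
  a cyclic arrangement the number of changes is twice the number of members minus twice the
  number of pairs of consecutive members, which determines the number of spokes.\<close>

lemma card_even_subgraph:
  assumes n: "n \<ge> 3" and C: "C \<subseteq> edges (prism n)"
    and ev: "\<And>w. even (card {e \<in> C. w \<in> e})"
  shows "card C + 2 * card {i. i < n \<and> outer n i \<in> C \<and> outer n (Suc i) \<in> C} =
    3 * card {i. i < n \<and> outer n i \<in> C} + card {i. i < n \<and> inner n i \<in> C}"
proof -
  let ?o = "\<lambda>i. of_bool (outer n i \<in> C) :: nat"
  have eqs: "outer n n = outer n 0" "spoke n n = spoke n 0"
    by (simp_all add: outer_def spoke_def mod_Suc)
  have "C = outer n ` {i. i < n \<and> outer n i \<in> C} \<union> inner n ` {i. i < n \<and> inner n i \<in> C}
       \<union> spoke n ` {i. i < n \<and> spoke n i \<in> C}" (is "_ = ?O \<union> ?I \<union> ?S")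
    using C by (auto simp: edges_prism)
  moreover have "card (?O \<union> ?I \<union> ?S) = card ?O + card ?I + card ?S"
    using n by (subst card_Un_disjoint; (subst card_Un_disjoint)?) (auto simp: prism_edge_eq_iff)
  moreover have "card ?O = card {i. i < n \<and> outer n i \<in> C}" "card ?I = card {i. i < n \<and> inner n i \<in> C}"
    "card ?S = card {i. i < n \<and> spoke n i \<in> C}"
    using inj_on_prism_edge[OF n] by (auto intro!: card_image intro: inj_on_subset)
  moreover have "card {i. i < n \<and> spoke n i \<in> C} + 2 * card {i. i < n \<and> outer n i \<in> C \<and> outer n (Suc i) \<in> C}
      = 2 * card {i. i < n \<and> outer n i \<in> C}"
  proof -
    have card: "card {i. i < n \<and> P i} = (\<Sum>i<n. of_bool (P i))" for P
      by (simp add: Int_def lessThan_def)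
    have "card {i. i < n \<and> spoke n i \<in> C} = (\<Sum>i<n. of_bool (spoke n (Suc i) \<in> C))"
      unfolding card by (rule sum_cyclic_shift[symmetric]) (simp add: eqs)
    also have "\<dots> + 2 * (\<Sum>i<n. of_bool (outer n i \<in> C \<and> outer n (Suc i) \<in> C)) = (\<Sum>i<n. ?o i + ?o (Suc i))"
      unfolding sum_distrib_left sum.distrib[symmetric]
      by (intro sum.cong refl) (simp add: spoke_in_even_subgraph_iff(1)[OF n C ev])
    also have "\<dots> = 2 * (\<Sum>i<n. ?o i)"
      unfolding sum.distrib using sum_cyclic_shift[of ?o n] by (simp add: eqs)
    finally show ?thesis unfolding card by simp
  qed
  ultimately show ?thesis by simp
qed

text \<open>
  By the two formulas for the spokes, whether exactly one of \<open>outer n i\<close> and \<open>inner n i\<close>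
  lies in \<open>C\<close> does not depend on \<open>i\<close>. If it does, \<open>C\<close> has \<open>n\<close> rim edges and an even number
  of spokes. Otherwise both or none lie in \<open>C\<close>, and since both cannot happen for even \<open>i\<close>, no two
  consecutive outer edges are in \<open>C\<close>; then the count of edges is divisible by 4.
\<close>

lemma even_subgraph_with_6_edges_winds:
  assumes n: "n \<ge> 3" and C: "C \<subseteq> edges (prism n)" and C6: "card C = 6"
    and ev: "\<And>w. even (card {e \<in> C. w \<in> e})"
    and not_both: "\<And>i. i < n \<Longrightarrow> even i \<Longrightarrow> \<not> (outer n i \<in> C \<and> inner n i \<in> C)"
  shows "(n = 4 \<or> n = 6) \<and> (\<forall>i<n. outer n i \<in> C \<longleftrightarrow> inner n i \<notin> C)"
proof -
  \<comment> \<open>the parity with which \<open>C\<close> crosses the cut between columns \<open>i\<close> and \<open>i + 1\<close>\<close>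
  define x where "x i = ((outer n i \<in> C) \<noteq> (inner n i \<in> C))" for i
  have "x (Suc i) = x i" for i
    using spoke_in_even_subgraph_iff[OF n C ev, of i] by (auto simp: x_def)
  then have x: "x i = x 0" for i by (induction i) simp_all
  note count = card_even_subgraph[OF n C ev]
  show ?thesis
  proof (cases "x 0")
    case True
    then have alt: "outer n i \<in> C \<longleftrightarrow> inner n i \<notin> C" for i
      using x[of i] unfolding x_def by blast
    have "{..<n} = {i. i < n \<and> outer n i \<in> C} \<union> {i. i < n \<and> inner n i \<in> C}"
      using alt by auto
    then have "n = card ({i. i < n \<and> outer n i \<in> C} \<union> {i. i < n \<and> inner n i \<in> C})"
      by (metis card_lessThan)
    also have "\<dots> = card {i. i < n \<and> outer n i \<in> C} + card {i. i < n \<and> inner n i \<in> C}"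
      using alt by (intro card_Un_disjoint) auto
    finally have sum: "n = card {i. i < n \<and> outer n i \<in> C} + card {i. i < n \<and> inner n i \<in> C}" .
    have "card {i. i < n \<and> outer n i \<in> C \<and> outer n (Suc i) \<in> C} \<le> card {i. i < n \<and> outer n i \<in> C}"
      by (intro card_mono) auto
    then obtain t where "card {i. i < n \<and> outer n i \<in> C} =
        card {i. i < n \<and> outer n i \<in> C \<and> outer n (Suc i) \<in> C} + t"
      using le_Suc_ex by blast
    then have "n + 2 * t = 6" using count sum C6 by linarith
    with n have "n = 4 \<or> n = 6" by presburger
    with alt show ?thesis by blast
  next
    case False
    then have same: "outer n i \<in> C \<longleftrightarrow> inner n i \<in> C" for i
      using x[of i] unfolding x_def by blast
    have "\<not> (outer n i \<in> C \<and> outer n (Suc i) \<in> C)" if "i < n" for i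
    proof (cases "even i \<or> Suc i < n")
      case True
      then show ?thesis using not_both[of i] not_both[of "Suc i"] same that by auto
    next
      case False
      \<comment> \<open>\<open>i\<close> is the last index, and its successor is the even index 0\<close>
      with that have "outer n (Suc i) = outer n 0" by (auto simp: outer_def mod_Suc)
      with n show ?thesis using not_both[of 0] same by auto
    qed
    then have "{i. i < n \<and> outer n i \<in> C \<and> outer n (Suc i) \<in> C} = {}" by auto
    then have "card {i. i < n \<and> outer n i \<in> C \<and> outer n (Suc i) \<in> C} = 0"
      by (simp only: card.empty)
    moreover have "card {i. i < n \<and> outer n i \<in> C} = card {i. i < n \<and> inner n i \<in> C}"
      by (simp only: same)
    ultimately have "6 = 4 * card {i. i < n \<and> outer n i \<in> C}" using count C6 by linarith
    then show ?thesis by presburger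
  qed
qed

lemma exists_prism_coloring:
  fixes p q r :: "nat \<Rightarrow> nat"
  assumes n: "n \<ge> 3"
  shows "\<exists>c. \<forall>i<n. c (outer n i) = p i \<and> c (inner n i) = q i \<and> c (spoke n i) = r i"
proof -
  define c where "c e = (if e \<in> outer n ` {..<n} then p (inv_into {..<n} (outer n) e)
    else if e \<in> inner n ` {..<n} then q (inv_into {..<n} (inner n) e)
    else r (inv_into {..<n} (spoke n) e))" for e
  show ?thesis
    using n by (intro exI[of _ c]) (auto simp: c_def inj_on_prism_edge prism_edge_eq_iff)
qed

text \<open>A winding hexagon contains one of \<open>outer n 0\<close>, \<open>inner n 0\<close> and one of \<open>outer n 2\<close>, \<open>inner n 2\<close>.
  It can occur only for \<open>n = 4\<close> and \<open>n = 6\<close>, which is when all four edges have the same color.\<close>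

lemma prism_coloring_no_rainbow:
  assumes n: "n \<ge> 3"
    and pairs: "\<And>i. i < n \<Longrightarrow> even i \<Longrightarrow> c (outer n i) = c (inner n i)"
    and wind: "n = 4 \<or> n = 6 \<Longrightarrow> c (outer n 2) = c (outer n 0)"
  shows "\<not> has_rainbow_copy (cycle_graph 6) (prism n) c"
proof
  assume "has_rainbow_copy (cycle_graph 6) (prism n) c"
  from rainbow_hexagon_is_even_subgraph[OF this]
  obtain C where C: "C \<subseteq> edges (prism n)" "card C = 6" "inj_on c C"
    "\<And>w. even (card {e \<in> C. w \<in> e})"
    by metis
  have "\<not> (outer n i \<in> C \<and> inner n i \<in> C)" if "i < n" "even i" for i
    using pairs[OF that] inj_onD[OF C(3), of "outer n i" "inner n i"] prism_edge_eq_iff(4)[OF n] by blast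
  from even_subgraph_with_6_edges_winds[OF n C(1,2,4) this]
  have n46: "n = 4 \<or> n = 6" and alt: "\<forall>i<n. outer n i \<in> C \<longleftrightarrow> inner n i \<notin> C" by auto
  have "\<exists>e\<in>{outer n 0, inner n 0}. e \<in> C" "\<exists>e\<in>{outer n 2, inner n 2}. e \<in> C"
    using alt[rule_format, of 0] alt[rule_format, of 2] n by auto
  then obtain e e' where e: "e \<in> {outer n 0, inner n 0}" "e \<in> C" "e' \<in> {outer n 2, inner n 2}" "e' \<in> C"
    by blast
  have "c e = c e'" using e wind[OF n46] pairs[of 0] pairs[of 2] n by auto
  then have "e = e'" using e inj_onD[OF C(3)] by blast
  with e n show False by (auto simp: prism_edge_eq_iff)
qed

text \<open>The color \<open>3 i + 2\<close> is used only for odd \<open>i\<close>, that is for \<open>i = 2 j + 1\<close> with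
  \<open>j < n div 2\<close>; this accounts for the half colors per column.\<close>

lemma exists_coloring_5n_div_2:
  assumes n: "n \<ge> 3" and "n \<noteq> 4" "n \<noteq> 6"
  shows "\<exists>c. \<not> has_rainbow_copy (cycle_graph 6) (prism n) c
    \<and> num_colors (prism n) c \<ge> 5 * n div 2"
proof -
  have "\<exists>c. \<forall>i<n. c (outer n i) = 3 * i \<and>
      c (inner n i) = (if even i then 3 * i else 3 * i + 2) \<and> c (spoke n i) = 3 * i + 1"
    using n by (rule exists_prism_coloring)
  then obtain c where c: "\<And>i. i < n \<Longrightarrow> c (outer n i) = 3 * i"
    "\<And>i. i < n \<Longrightarrow> c (inner n i) = (if even i then 3 * i else 3 * i + 2)"
    "\<And>i. i < n \<Longrightarrow> c (spoke n i) = 3 * i + 1"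
    by metis
  let ?A = "(\<lambda>i. 3 * i) ` {..<n}" and ?B = "(\<lambda>i. 3 * i + 1) ` {..<n}"
  let ?D = "(\<lambda>j. 3 * (2 * j + 1) + 2) ` {..<n div 2}"
  have "?A \<union> ?B \<union> ?D \<subseteq> c ` edges (prism n)"
  proof -
    have "3 * i \<in> c ` edges (prism n)" if "i < n" for i
      using c(1)[OF that] that by (force simp: edges_prism)
    moreover have "3 * i + 1 \<in> c ` edges (prism n)" if "i < n" for i
      using c(3)[OF that] that by (force simp: edges_prism)
    moreover have "3 * (2 * j + 1) + 2 \<in> c ` edges (prism n)" if "j < n div 2" for j
    proof -
      have "2 * j + 1 < n" using that by linarith
      then show ?thesis
        using c(2)[of "2 * j + 1"] by (force simp: edges_prism)
    qed
    ultimately show ?thesis by blast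
  qed
  moreover have "finite (c ` edges (prism n))" by (simp add: edges_prism)
  ultimately have "card (?A \<union> ?B \<union> ?D) \<le> num_colors (prism n) c"
    unfolding num_colors_def by (rule card_mono[rotated])
  moreover have "card (?A \<union> ?B \<union> ?D) = card ?A + card ?B + card ?D"
    by (subst card_Un_disjoint; (subst card_Un_disjoint)?; (auto; presburger)?)
  moreover have "card ?A = n" "card ?B = n" "card ?D = n div 2"
    by (simp_all add: card_image inj_on_def)
  moreover have "\<not> has_rainbow_copy (cycle_graph 6) (prism n) c"
    using assms c by (intro prism_coloring_no_rainbow) auto
  ultimately show ?thesis by (intro exI[of _ c]) linarith
qed

lemma exists_coloring_4_6:
  assumes n: "n = 4 \<or> n = 6"
  shows "\<exists>c. \<not> has_rainbow_copy (cycle_graph 6) (prism n) c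
    \<and> num_colors (prism n) c \<ge> 5 * n div 2 - 1"
proof -
  \<comment> \<open>color 0 is shared by the outer edges 0 and 2, and then by the inner edges 0 and 2\<close>
  define p where "p i = (if i = 2 then 0 else 3 * i)" for i :: nat
  define q where "q i = (if even i then p i else 3 * i + 2)" for i :: nat
  have n3: "n \<ge> 3" using n by auto
  have "\<exists>c. \<forall>i<n. c (outer n i) = p i \<and> c (inner n i) = q i \<and> c (spoke n i) = 3 * i + 1"
    using n3 by (rule exists_prism_coloring)
  then obtain c where c: "\<And>i. i < n \<Longrightarrow> c (outer n i) = p i"
    "\<And>i. i < n \<Longrightarrow> c (inner n i) = q i" "\<And>i. i < n \<Longrightarrow> c (spoke n i) = 3 * i + 1"
    by metis
  have "c ` edges (prism n) = p ` {..<n} \<union> (\<lambda>i. 3 * i + 1) ` {..<n} \<union> q ` {..<n}"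
    unfolding edges_prism image_Un image_image using c
    by (intro arg_cong2[of _ _ _ _ "(\<union>)"] image_cong) auto
  moreover have "card \<dots> = 5 * n div 2 - 1"
  proof -
    have "{..<4} = {0, 1, 2, 3 :: nat}" "{..<6} = {0, 1, 2, 3, 4, 5 :: nat}" by auto
    with n show ?thesis by (elim disjE) (simp_all add: p_def q_def card_insert_if)
  qed
  ultimately have "num_colors (prism n) c = 5 * n div 2 - 1"
    by (simp add: num_colors_def)
  moreover have "\<not> has_rainbow_copy (cycle_graph 6) (prism n) c"
    using n3 c by (intro prism_coloring_no_rainbow) (auto simp: p_def q_def)
  ultimately show ?thesis by auto
qed

section \<open>Ladders and the general upper bound\<close>

text \<open>The middle spoke \<open>spoke n (i + 1)\<close> is a chord of this hexagon.\<close>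

definition ladder :: "nat \<Rightarrow> nat \<Rightarrow> petersen_vertex set set" where
  "ladder n i = {outer n i, outer n (Suc i), inner n i, inner n (Suc i), spoke n i, spoke n (i + 2)}"

lemma ladder_rainbow:
  assumes n: "n \<ge> 3" and "inj_on c (ladder n i)"
  shows "has_rainbow_copy (cycle_graph 6) (prism n) c"
proof -
  let ?U = "\<lambda>j. U ((i + j) mod n)" and ?V = "\<lambda>j. V ((i + j) mod n)"
  have L: "{{?U 0, ?U 1}, {?U 1, ?U 2}, {?U 2, ?V 2}, {?V 2, ?V 1}, {?V 1, ?V 0}, {?V 0, ?U 0}} = ladder n i"
    unfolding ladder_def outer_def inner_def spoke_def by (simp add: insert_commute)
  show ?thesis
  proof (rule rainbow_hexagonI[of "?U 0" "?U 1" "?U 2" "?V 2" "?V 1" "?V 0"], unfold L)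
    show "distinct [?U 0, ?U 1, ?U 2, ?V 2, ?V 1, ?V 0]"
      using n by (auto simp: mod_Suc split: if_splits)
    show "{?U 0, ?U 1, ?U 2, ?V 2, ?V 1, ?V 0} \<subseteq> verts (prism n)"
      using n by (auto simp: prism_def gen_petersen_def)
    show "ladder n i \<subseteq> edges (prism n)"
      using n prism_edges_memI[of n] by (auto simp: ladder_def)
  qed (fact assms)
qed

lemma ladders_through_edge:
  assumes n: "n \<ge> 3" and j: "j < n"
  shows "{i \<in> {..<n}. outer n j \<in> ladder n i} \<subseteq> {j, if j = 0 then n - 1 else j - 1}"
    and "{i \<in> {..<n}. inner n j \<in> ladder n i} \<subseteq> {j, if j = 0 then n - 1 else j - 1}"
    and "{i \<in> {..<n}. spoke n j \<in> ladder n i} \<subseteq> {j, if j < 2 then j + n - 2 else j - 2}"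
  using assms by (auto simp: ladder_def prism_edge_eq_iff mod_Suc split: if_splits)

lemma card_ladders_through_edge:
  assumes n: "n \<ge> 3" and x: "x \<in> edges (prism n)"
  shows "card {i \<in> {..<n}. x \<in> ladder n i} \<le> 2"
proof -
  have two: "card A \<le> 2" if "A \<subseteq> {a, b}" for A :: "nat set" and a b
    using card_mono[OF _ that] by (simp add: card_insert_if split: if_splits)
  show ?thesis
    using x ladders_through_edge[OF n, THEN two] by (auto simp: edges_prism)
qed

text \<open>Here \<open>d = l = 2\<close>: the condition on pairs is implied by the one on single edges.\<close>

lemma num_colors_prism_le:
  assumes n: "n \<ge> 3" and c: "\<not> has_rainbow_copy (cycle_graph 6) (prism n) c"
  shows "num_colors (prism n) c \<le> 5 * n div 2"
proof -
  have "card {..<n} + 2 * card (c ` edges (prism n)) \<le> 2 * card (edges (prism n))"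
  proof (rule card_nonrainbow_family_le[where F = "ladder n" and d = 2])
    show "finite (edges (prism n))" by (simp add: edges_prism)
    show "ladder n i \<subseteq> edges (prism n)" for i
      using n prism_edges_memI[of n] by (auto simp: ladder_def)
    show "card {i \<in> {..<n}. x \<in> ladder n i} \<le> 2" if "x \<in> edges (prism n)" for x
      by (rule card_ladders_through_edge[OF n that])
    show "card ({i \<in> {..<n}. x \<in> ladder n i} \<inter> {i \<in> {..<n}. y \<in> ladder n i}) \<le> 2"
      if "x \<in> edges (prism n)" for x y
      by (rule le_trans[OF card_mono card_ladders_through_edge[OF n that]]) auto
    show "\<not> inj_on c (ladder n i)" for i
      using ladder_rainbow[OF n] c by blast
  qed auto
  then show ?thesis
    using card_edges_prism[OF n] by (simp add: num_colors_def)
qed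

section \<open>The prism over the 6-cycle\<close>

lemma rim_rainbow:
  assumes "inj_on c (outer 6 ` {..<6}) \<or> inj_on c (inner 6 ` {..<6})"
  shows "has_rainbow_copy (cycle_graph 6) (prism 6) c"
proof -
  have rim: "{f 0, f 1, f 2, f 3, f 4, f 5} = f ` {..<6}" for f :: "nat \<Rightarrow> petersen_vertex set"
  proof -
    have "{..<6} = {0, 1, 2, 3, 4, 5 :: nat}" by auto
    then show ?thesis by simp
  qed
  have O: "{{U 0, U 1}, {U 1, U 2}, {U 2, U 3}, {U 3, U 4}, {U 4, U 5}, {U 5, U 0}} = outer 6 ` {..<6}"
    and I: "{{V 0, V 1}, {V 1, V 2}, {V 2, V 3}, {V 3, V 4}, {V 4, V 5}, {V 5, V 0}} = inner 6 ` {..<6}"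
    unfolding rim[symmetric] outer_def inner_def by (simp_all del: One_nat_def add: Suc_eq_plus1)
  have E: "outer 6 ` {..<6} \<subseteq> edges (prism 6)" "inner 6 ` {..<6} \<subseteq> edges (prism 6)"
    by (auto simp: edges_prism)
  have V: "U i \<in> verts (prism 6)" "V i \<in> verts (prism 6)" if "i < 6" for i
    using that by (auto simp: prism_def gen_petersen_def)
  from assms show ?thesis
  proof
    assume "inj_on c (outer 6 ` {..<6})"
    then show ?thesis
      using E V rainbow_hexagonI[of "U 0" "U 1" "U 2" "U 3" "U 4" "U 5" "prism 6" c, unfolded O] by simp
  next
    assume "inj_on c (inner 6 ` {..<6})"
    then show ?thesis
      using E V rainbow_hexagonI[of "V 0" "V 1" "V 2" "V 3" "V 4" "V 5" "prism 6" c, unfolded I] by simp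
  qed
qed

text \<open>
  Apply the counting lemma to the six ladders and the two rims, with \<open>d = 3\<close> and \<open>l = 2\<close>. Only rim edges
  lie on three members of the family. For the bound on pairs, two edges of the same rim share that
  rim and at most one ladder, and two edges that are not on a common rim share at most the two ladders.
  Then \<open>8 + 2 k \<le> 2 \<sqdot> 18\<close> for \<open>k\<close> colors.
\<close>

lemma num_colors_prism_6_le:
  assumes c: "\<not> has_rainbow_copy (cycle_graph 6) (prism 6) c"
  shows "num_colors (prism 6) c \<le> 14"
proof -
  define H where "H i = (if i < 6 then ladder 6 i else if i = 6 then outer 6 ` {..<6} else inner 6 ` {..<6})"
    for i :: nat
  define inc where "inc x = {i \<in> {..<6}. x \<in> ladder 6 i}" for x
  have inc_H: "{i \<in> {..<8}. x \<in> H i} =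
      inc x \<union> (if x \<in> outer 6 ` {..<6} then {6} else {}) \<union> (if x \<in> inner 6 ` {..<6} then {7} else {})" for x
    by (auto simp: H_def inc_def)
  have fin: "finite (inc x)" and le2: "x \<in> edges (prism 6) \<Longrightarrow> card (inc x) \<le> 2" for x
    using card_ladders_through_edge[of 6 x] by (simp_all add: inc_def)
  have disj: "outer 6 ` {..<6} \<inter> inner 6 ` {..<6} = {}"
    by (auto simp: prism_edge_eq_iff)
  \<comment> \<open>different pairs have at most one element in common\<close>
  have share: "card (A \<inter> B) \<le> 1"
    if A: "A \<subseteq> {a, a'}" and B: "B \<subseteq> {b, b'}" and ne: "a \<noteq> b" "\<not> (a = b' \<and> a' = b)"
    for A B :: "nat set" and a a' b b'
  proof -
    have "i = k" if "i \<in> A \<inter> B" "k \<in> A \<inter> B" for i k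
      using that A B ne by blast
    moreover have "finite (A \<inter> B)" using A by (meson finite.intros finite_Int finite_subset)
    ultimately show ?thesis by (simp add: card_le_Suc0_iff_eq)
  qed
  have le1: "card (inc x \<inter> inc y) \<le> 1"
    if "x \<noteq> y" and rim: "x \<in> outer 6 ` {..<6} \<and> y \<in> outer 6 ` {..<6} \<or> x \<in> inner 6 ` {..<6} \<and> y \<in> inner 6 ` {..<6}"
    for x y
    using rim
  proof (elim disjE conjE imageE)
    fix a b assume ab: "x = outer 6 a" "y = outer 6 b" "a \<in> {..<6}" "b \<in> {..<6}"
    show ?thesis
      unfolding inc_def ab(1,2)
    proof (rule share[OF ladders_through_edge(1) ladders_through_edge(1)])
      show "a \<noteq> b" using ab \<open>x \<noteq> y\<close> by blast
      then show "\<not> (a = (if b = 0 then 6 - 1 else b - 1) \<and> (if a = 0 then 6 - 1 else a - 1) = b)"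
        using ab(3,4) by auto
    qed (use ab in auto)
  next
    fix a b assume ab: "x = inner 6 a" "y = inner 6 b" "a \<in> {..<6}" "b \<in> {..<6}"
    show ?thesis
      unfolding inc_def ab(1,2)
    proof (rule share[OF ladders_through_edge(2) ladders_through_edge(2)])
      show "a \<noteq> b" using ab \<open>x \<noteq> y\<close> by blast
      then show "\<not> (a = (if b = 0 then 6 - 1 else b - 1) \<and> (if a = 0 then 6 - 1 else a - 1) = b)"
        using ab(3,4) by auto
    qed (use ab in auto)
  qed
  have "card {..<8::nat} + 2 * card (c ` edges (prism 6)) \<le> 2 * card (edges (prism 6))"
  proof (rule card_nonrainbow_family_le[where F = H and d = 3])
    show "finite (edges (prism 6))" by (simp add: edges_prism)
    show "H i \<subseteq> edges (prism 6)" for i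
      using prism_edges_memI[of 6] by (auto simp: H_def ladder_def)
    show "card {i \<in> {..<8}. x \<in> H i} \<le> 3" if "x \<in> edges (prism 6)" for x
      unfolding inc_H using le2[OF that] disj fin[of x]
      by (auto simp: card_insert_if)
    show "card ({i \<in> {..<8}. x \<in> H i} \<inter> {i \<in> {..<8}. y \<in> H i}) \<le> 2"
      if xy: "x \<in> edges (prism 6)" "y \<in> edges (prism 6)" "x \<noteq> y" for x y
    proof (cases "x \<in> outer 6 ` {..<6} \<and> y \<in> outer 6 ` {..<6} \<or> x \<in> inner 6 ` {..<6} \<and> y \<in> inner 6 ` {..<6}")
      case True
      then have "{i \<in> {..<8}. x \<in> H i} \<inter> {i \<in> {..<8}. y \<in> H i} \<subseteq>
          insert (if x \<in> outer 6 ` {..<6} then 6 else 7) (inc x \<inter> inc y)"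
        unfolding inc_H using disj by (auto simp: inc_def)
      then have "card ({i \<in> {..<8}. x \<in> H i} \<inter> {i \<in> {..<8}. y \<in> H i}) \<le>
          card (insert (if x \<in> outer 6 ` {..<6} then 6 else 7) (inc x \<inter> inc y))"
        by (rule card_mono[rotated]) (simp add: fin)
      also have "\<dots> \<le> Suc (card (inc x \<inter> inc y))" by (rule card_insert_le_m1) auto
      finally show ?thesis using le1[OF xy(3) True] by linarith
    next
      case False
      then have "{i \<in> {..<8}. x \<in> H i} \<inter> {i \<in> {..<8}. y \<in> H i} \<subseteq> inc x"
        unfolding inc_H by (auto simp: inc_def split: if_splits)
      then have "card ({i \<in> {..<8}. x \<in> H i} \<inter> {i \<in> {..<8}. y \<in> H i}) \<le> card (inc x)"
        by (rule card_mono[OF fin])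
      with le2[OF xy(1)] show ?thesis by linarith
    qed
    show "\<not> inj_on c (H i)" for i
    proof
      assume inj: "inj_on c (H i)"
      have "has_rainbow_copy (cycle_graph 6) (prism 6) c"
      proof (cases "i < 6")
        case True
        with inj ladder_rainbow[of 6 c i] show ?thesis by (simp add: H_def)
      next
        case False
        then have "inj_on c (outer 6 ` {..<6}) \<or> inj_on c (inner 6 ` {..<6})"
          using inj by (auto simp: H_def split: if_splits)
        then show ?thesis by (rule rim_rainbow)
      qed
      with c show False ..
    qed
  qed auto
  then show ?thesis
    using card_edges_prism[of 6] by (simp add: num_colors_def)
qed

section \<open>The cube\<close>

text \<open>The boundary of the union of a rim face of the cube and an adjacent side face: three edges of
  the rim \<open>f\<close>, two spokes, and one edge of the opposite rim \<open>g\<close>.\<close>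

definition winding_hexagon :: "(nat \<Rightarrow> nat \<Rightarrow> petersen_vertex set) \<Rightarrow>
    (nat \<Rightarrow> nat \<Rightarrow> petersen_vertex set) \<Rightarrow> nat \<Rightarrow> petersen_vertex set set" where
  "winding_hexagon f g i = {f 4 (i + 1), f 4 (i + 2), f 4 (i + 3), spoke 4 i, spoke 4 (i + 1), g 4 i}"

lemma winding_hexagon_rainbow:
  assumes "inj_on c (winding_hexagon outer inner i) \<or> inj_on c (winding_hexagon inner outer i)"
  shows "has_rainbow_copy (cycle_graph 6) (prism 4) c"
proof -
  let ?U = "\<lambda>j. U ((i + j) mod 4)" and ?V = "\<lambda>j. V ((i + j) mod 4)"
  have 4: "(i + 4) mod 4 = i mod 4" by simp
  have O: "{{?U 1, ?U 2}, {?U 2, ?U 3}, {?U 3, ?U 0}, {?U 0, ?V 0}, {?V 0, ?V 1}, {?V 1, ?U 1}} =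
      winding_hexagon outer inner i"
    unfolding winding_hexagon_def outer_def inner_def spoke_def using 4
    by (simp add: insert_commute add.commute[of 3 i])
  have I: "{{?V 1, ?V 2}, {?V 2, ?V 3}, {?V 3, ?V 0}, {?V 0, ?U 0}, {?U 0, ?U 1}, {?U 1, ?V 1}} =
      winding_hexagon inner outer i"
    unfolding winding_hexagon_def outer_def inner_def spoke_def using 4
    by (simp add: insert_commute add.commute[of 3 i])
  have V: "U (j mod 4) \<in> verts (prism 4)" "V (j mod 4) \<in> verts (prism 4)" for j
    by (auto simp: prism_def gen_petersen_def)
  have dist: "distinct [(i + 1) mod 4, (i + 2) mod 4, (i + 3) mod 4, (i + 0) mod 4]"
  proof -
    have "i mod 4 = 0 \<or> i mod 4 = 1 \<or> i mod 4 = 2 \<or> i mod 4 = 3"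
      using mod_less_divisor[of 4 i] by linarith
    then show ?thesis
      unfolding mod_add_left_eq[of i 4, symmetric] by (elim disjE) (simp_all only:, simp_all)
  qed
  have E: "winding_hexagon outer inner i \<subseteq> edges (prism 4)" "winding_hexagon inner outer i \<subseteq> edges (prism 4)"
    using prism_edges_memI[of 4] by (auto simp: winding_hexagon_def)
  from assms show ?thesis
  proof
    assume "inj_on c (winding_hexagon outer inner i)"
    then show ?thesis
      using E V dist rainbow_hexagonI[of "?U 1" "?U 2" "?U 3" "?U 0" "?V 0" "?V 1" "prism 4" c, unfolded O]
      by simp
  next
    assume "inj_on c (winding_hexagon inner outer i)"
    then show ?thesis
      using E V dist rainbow_hexagonI[of "?V 1" "?V 2" "?V 3" "?V 0" "?U 0" "?U 1" "prism 4" c, unfolded I]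
      by simp
  qed
qed

text \<open>
  Apply the counting lemma to the eight winding hexagons, with \<open>d = 4\<close> and \<open>l = 3\<close>. Every edge lies on
  exactly four of them, and the table in the proof shows that no two edges lie on the same four.
  Then \<open>8 + 3 k \<le> 3 \<sqdot> 12\<close> for \<open>k\<close> colors, so \<open>k \<le> 9\<close>. The four ladders alone
  would only give 10.
\<close>

lemma num_colors_prism_4_le:
  assumes c: "\<not> has_rainbow_copy (cycle_graph 6) (prism 4) c"
  shows "num_colors (prism 4) c \<le> 9"
proof -
  \<comment> \<open>edges depend on \<open>i\<close> modulo 4, so the indices 4 to 7 run through all hexagons of the second kind\<close>
  define K where "K i = (if i < 4 then winding_hexagon outer inner i else winding_hexagon inner outer i)"
    for i :: nat
  define inc where "inc x = {i \<in> {..<8}. x \<in> K i}" for x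
  have inc: "inc x = set (filter (\<lambda>i. x \<in> K i) [0, 1, 2, 3, 4, 5, 6, 7])" for x
  proof -
    have "[0, 1, 2, 3, 4, 5, 6, 7 :: nat] = [0..<8]" by (simp add: upt_rec)
    then show ?thesis by (auto simp: inc_def)
  qed
  have table: "inc (outer 4 0) = {1, 2, 3, 4}" "inc (outer 4 1) = {0, 2, 3, 5}"
    "inc (outer 4 2) = {0, 1, 3, 6}" "inc (outer 4 3) = {0, 1, 2, 7}"
    "inc (inner 4 0) = {0, 5, 6, 7}" "inc (inner 4 1) = {1, 4, 6, 7}"
    "inc (inner 4 2) = {2, 4, 5, 7}" "inc (inner 4 3) = {3, 4, 5, 6}"
    "inc (spoke 4 0) = {0, 3, 4, 7}" "inc (spoke 4 1) = {0, 1, 4, 5}"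
    "inc (spoke 4 2) = {1, 2, 5, 6}" "inc (spoke 4 3) = {2, 3, 6, 7}"
    unfolding inc K_def winding_hexagon_def
    by (simp_all add: prism_edge_eq_iff del: One_nat_def)
  have four: "{..<4} = {0, 1, 2, 3 :: nat}" by auto
  have E: "edges (prism 4) = {outer 4 0, outer 4 1, outer 4 2, outer 4 3, spoke 4 0, spoke 4 1, spoke 4 2, spoke 4 3,
      inner 4 0, inner 4 1, inner 4 2, inner 4 3}"
    unfolding edges_prism four by (simp only: image_insert image_empty Un_insert_left Un_empty_left)
  have card4: "card (inc x) = 4" if "x \<in> edges (prism 4)" for x
    using that unfolding E by (auto simp: table simp del: One_nat_def)
  have inj: "x = y" if "x \<in> edges (prism 4)" "y \<in> edges (prism 4)" "inc x = inc y" for x y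
  proof -
    \<comment> \<open>encode finite sets of indices as binary numbers and count the codes\<close>
    define code where "code S = (\<Sum>k\<in>S. 2 ^ k :: nat)" for S :: "nat set"
    have "(code \<circ> inc) ` edges (prism 4) = {30, 45, 75, 135, 153, 51, 102, 204, 225, 210, 180, 120}"
      unfolding E by (simp add: table code_def del: One_nat_def)
    then have "card ((code \<circ> inc) ` edges (prism 4)) = card (edges (prism 4))"
      using card_edges_prism[of 4] by simp
    then have "inj_on (code \<circ> inc) (edges (prism 4))"
      by (intro eq_card_imp_inj_on) (simp_all add: edges_prism)
    then have "inj_on inc (edges (prism 4))" by (rule inj_on_imageI2)
    from inj_onD[OF this that(3,1,2)] show ?thesis .
  qed
  have "card {..<8::nat} + 3 * card (c ` edges (prism 4)) \<le> 3 * card (edges (prism 4))"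
  proof (rule card_nonrainbow_family_le[where F = K and d = 4], fold inc_def)
    show "finite (edges (prism 4))" by (simp add: edges_prism)
    show "K i \<subseteq> edges (prism 4)" for i
      using prism_edges_memI[of 4] by (auto simp: K_def winding_hexagon_def)
    show "card (inc x) \<le> 4" if "x \<in> edges (prism 4)" for x
      using card4[OF that] by simp
    show "card (inc x \<inter> inc y) \<le> 3"
      if xy: "x \<in> edges (prism 4)" "y \<in> edges (prism 4)" "x \<noteq> y" for x y
    proof (rule ccontr)
      assume "\<not> ?thesis"
      moreover have fin: "finite (inc x)" "finite (inc y)" by (simp_all add: inc_def)
      ultimately have "inc x \<inter> inc y = inc x" "inc x \<inter> inc y = inc y"
        using card4[OF xy(1)] card4[OF xy(2)]
          card_seteq[OF fin(1) Int_lower1, of "inc y"] card_seteq[OF fin(2) Int_lower2, of "inc x"]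
        by linarith+
      with inj[OF xy(1,2)] xy(3) show False by blast
    qed
    show "\<not> inj_on c (K i)" for i
      using winding_hexagon_rainbow[of c i] c by (auto simp: K_def)
  qed auto
  then show ?thesis
    using card_edges_prism[of 4] by (simp add: num_colors_def)
qed

theorem theorem1p3:
  fixes n :: nat
  assumes "n \<ge> 3"
  shows "anti_ramsey (gen_petersen n 1) (cycle_graph 6) =
    (if n = 3 then 7
     else if n = 4 then 9
     else if n = 6 then 14
     else (5 * n) div 2)"
proof -
  let ?r = "if n = 4 then 9 else if n = 6 then 14 else (5 * n) div 2"
  have "\<exists>c. \<not> has_rainbow_copy (cycle_graph 6) (prism n) c \<and> num_colors (prism n) c \<ge> ?r"
    using exists_coloring_5n_div_2[OF assms] exists_coloring_4_6[of n] by (auto split: if_splits)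
  moreover have "num_colors (prism n) c \<le> ?r" if "\<not> has_rainbow_copy (cycle_graph 6) (prism n) c" for c
    using that num_colors_prism_le[OF assms that] num_colors_prism_4_le[of c] num_colors_prism_6_le[of c]
    by auto
  moreover have "finite (edges (prism n))" by (simp add: edges_prism)
  ultimately have "anti_ramsey (prism n) (cycle_graph 6) = ?r"
    using anti_ramsey_eqI by blast
  then show ?thesis by (simp add: prism_def)
qed

end
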